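(* Let $\Phi=(A;\{E_i\}_{i=0}^d;A^*;\{E^*_i\}_{i=0}^d)$ be a sharp tridiagonal system on $V$ with eigenvalue sequence $\{\theta_i\}_{i=0}^d$, dual eigenvalue sequence $\{\theta^*_i\}_{i=0}^d$ and split sequence $\{\zeta_i\}_{i=0}^d$. Then for $0\le i\le d$ both $$E_0\,\tau^*_i(A^* )\,\tau_i(A)\,E^*_0=\zeta_i\,E_0E^*_0,\qquad E^*_0\,\tau_i(A)\,\tau^*_i(A^* )\,E_0=\zeta_i\,E^*_0E_0.$$
   Context: $\mathbb{K}$ is a field and $V$ is a $\mathbb{K}$-vector space of finite positive dimension; $\mathrm{End}(V)$ is the algebra of $\mathbb{K}$-linear maps $V\to V$, with identity $I$. "Diagonalizable" means $V$ is spanned by the eigenspaces. A tridiagonal pair on $V$ is an ordered pair $A,A^*\in\mathrm{End}(V)$ ($A^*$ is just a name, not an adjoint) such that: (i) each of $A,A^*$ is diagonalizable; (ii) there is an ordering $\{V_i\}_{i=0}^d$ of the eigenspaces of $A$ with $A^*V_i\subseteq V_{i-1}+V_i+V_{i+1}$ for $0\le i\le d$ (where $V_{-1}=V_{d+1}=0$); (iii) there is an ordering $\{V^*_i\}_{i=0}^\delta$ of the eigenspaces of $A^*$ with $AV^*_i\subseteq V^*_{i-1}+V^*_i+V^*_{i+1}$ for $0\le i\le\delta$ (where $V^*_{-1}=V^*_{\delta+1}=0$); (iv) no subspace $W$ with $0\ne W\ne V$ satisfies $AW\subseteq W$ and $A^*W\subseteq W$. Orderings as in (ii), (iii) are called standard.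 It is known that $d=\delta$ and that $V_i,V_{d-i},V^*_i,V^*_{d-i}$ all have the same dimension for $0\le i\le d$. A tridiagonal system on $V$ is a sequence $\Phi=(A;\{E_i\}_{i=0}^d;A^*;\{E^*_i\}_{i=0}^d)$ where $A,A^*$ is a tridiagonal pair on $V$ and $\{E_i\}$ (resp. $\{E^*_i\}$) are the primitive idempotents (projections onto the eigenspaces along the other eigenspaces) of $A$ (resp. $A^*$), ordered so that the eigenspaces $\{E_iV\}$ (resp. $\{E^*_iV\}$) are in a standard order. $\theta_i$ (resp. $\theta^*_i$) is the eigenvalue of $A$ (resp. $A^*$) on $E_iV$ (resp. $E^*_iV$); $\{\theta_i\}$ and $\{\theta_i^*\}$ are the eigenvalue sequence and dual eigenvalue sequence of $\Phi$. $\Phi$ is sharp if $\dim E_0V=1$ (equivalently $\dim E^*_0V=1$). For an indeterminate $\lambda$ and $0\le i\le d$: $\tau_i=(\lambda-\theta_0)(\lambda-\theta_1)\cdots(\lambda-\theta_{i-1})$ and $\tau^*_i=(\lambda-\theta^*_0)(\lambda-\theta^*_1)\cdots(\lambda-\theta^*_{i-1})$. Split sequence: let $U_i=(E^*_0V+\cdots+E^*_iV)\cap(E_iV+\cdots+E_dV)$ for $0\le i\le d$. It is known that $V=U_0+\cdots+U_d$ is a direct sum, $U_0=E_0^*V$, $(A-\theta_iI)U_i\subseteq U_{i+1}$ and $(A^*-\theta^*_iI)U_i\subseteq U_{i-1}$ ($U_{-1}=U_{d+1}=0$). If $\Phi$ is sharp, $\dim U_0=1$ and $U_0$ is invariant under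 $(A^*-\theta^*_1I)(A^*-\theta^*_2I)\cdots(A^*-\theta^*_iI)(A-\theta_{i-1}I)\cdots(A-\theta_1I)(A-\theta_0I)$; the corresponding eigenvalue is $\zeta_i$, and $\{\zeta_i\}_{i=0}^d$ is the split sequence of $\Phi$. *)

theory Defs
  imports Complex_Main "HOL-Computational_Algebra.Polynomial" "HOL-Library.Set_Algebras"
begin

text \<open>
  The vector space is the whole type of vectors, with scalar multiplication \<open>*s\<close>; an element of
  its endomorphism algebra is a function satisfying \<^const>\<open>Vector_Spaces.linear\<close>.
  Sums of subspaces are the elementwise sums of sets from \<^theory>\<open>HOL-Library.Set_Algebras\<close>.
\<close>

locale linear_space = vector_space scale
  for scale :: "'a::field \<Rightarrow> 'b::ab_group_add \<Rightarrow> 'b" (infixr "*s" 75)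
begin

definition eigenspace :: "('b \<Rightarrow> 'b) \<Rightarrow> 'a \<Rightarrow> 'b set" where
  "eigenspace A c = {v. A v = c *s v}"

text \<open>Only nonzero eigenspaces, i.e. those belonging to an actual eigenvalue.\<close>

definition eigenspaces :: "('b \<Rightarrow> 'b) \<Rightarrow> 'b set set" where
  "eigenspaces A = {W. W \<noteq> {0} \<and> (\<exists>c. W = eigenspace A c)}"

definition diagonalizable :: "('b \<Rightarrow> 'b) \<Rightarrow> bool" where
  "diagonalizable A \<longleftrightarrow> span (\<Union>(eigenspaces A)) = UNIV"

definition standard_ordering :: "('b \<Rightarrow> 'b) \<Rightarrow> ('b \<Rightarrow> 'b) \<Rightarrow> nat \<Rightarrow> (nat \<Rightarrow> 'b set) \<Rightarrow> bool" where
  "standard_ordering A B d V \<longleftrightarrow>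
     bij_betw V {0..d} (eigenspaces A) \<and>
     (\<forall>i\<le>d. B ` V i \<subseteq> (if i = 0 then {0} else V (i - 1)) + V i + (if i = d then {0} else V (i + 1)))"

definition tridiagonal_pair :: "('b \<Rightarrow> 'b) \<Rightarrow> ('b \<Rightarrow> 'b) \<Rightarrow> bool" where
  "tridiagonal_pair A As \<longleftrightarrow>
     Vector_Spaces.linear scale scale A \<and> Vector_Spaces.linear scale scale As \<and>
     diagonalizable A \<and> diagonalizable As \<and>
     (\<exists>d V. standard_ordering A As d V) \<and>
     (\<exists>\<delta> Vs. standard_ordering As A \<delta> Vs) \<and>
     \<not> (\<exists>W. subspace W \<and> W \<noteq> {0} \<and> W \<noteq> UNIV \<and> A ` W \<subseteq> W \<and> As ` W \<subseteq> W)"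

text \<open>The projection onto one eigenspace along the (sum of the) other eigenspaces.\<close>

definition primitive_idempotent :: "('b \<Rightarrow> 'b) \<Rightarrow> ('b \<Rightarrow> 'b) \<Rightarrow> bool" where
  "primitive_idempotent A F \<longleftrightarrow>
     Vector_Spaces.linear scale scale F \<and>
     (\<exists>W\<in>eigenspaces A. (\<forall>v\<in>W. F v = v) \<and> (\<forall>W'\<in>eigenspaces A - {W}. \<forall>v\<in>W'. F v = 0))"

definition tridiagonal_system ::
    "nat \<Rightarrow> ('b \<Rightarrow> 'b) \<Rightarrow> (nat \<Rightarrow> 'b \<Rightarrow> 'b) \<Rightarrow> ('b \<Rightarrow> 'b) \<Rightarrow> (nat \<Rightarrow> 'b \<Rightarrow> 'b) \<Rightarrow> bool" where
  "tridiagonal_system d A E As Es \<longleftrightarrow>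
     tridiagonal_pair A As \<and>
     bij_betw E {0..d} {F. primitive_idempotent A F} \<and>
     bij_betw Es {0..d} {F. primitive_idempotent As F} \<and>
     standard_ordering A As d (\<lambda>i. range (E i)) \<and>
     standard_ordering As A d (\<lambda>i. range (Es i))"

definition sharp :: "(nat \<Rightarrow> 'b \<Rightarrow> 'b) \<Rightarrow> bool" where
  "sharp E \<longleftrightarrow> dim (range (E 0)) = 1"

text \<open>
  The scalar by which \<open>X\<close> acts on \<open>W\<close>; meaningful if \<open>W\<close> contains a nonzero vector and \<open>X\<close> acts on
  \<open>W\<close> as a scalar, see the lemma below.
\<close>

definition eigenvalue_on :: "('b \<Rightarrow> 'b) \<Rightarrow> 'b set \<Rightarrow> 'a" where
  "eigenvalue_on X W = (THE c. \<forall>w\<in>W. X w = c *s w)"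

lemma eigenvalue_on_eqI:
  assumes "w \<in> W" "w \<noteq> 0" "\<And>v. v \<in> W \<Longrightarrow> X v = c *s v"
  shows "eigenvalue_on X W = c"
  unfolding eigenvalue_on_def
  by (rule the_equality) (use assms in \<open>auto simp: scale_right_imp_eq\<close>)

definition eigenvalue_seq :: "('b \<Rightarrow> 'b) \<Rightarrow> (nat \<Rightarrow> 'b \<Rightarrow> 'b) \<Rightarrow> nat \<Rightarrow> 'a" where
  "eigenvalue_seq A E i = eigenvalue_on A (range (E i))"

definition poly_end :: "'a poly \<Rightarrow> ('b \<Rightarrow> 'b) \<Rightarrow> 'b \<Rightarrow> 'b" where
  "poly_end p A = (\<lambda>v. \<Sum>k\<le>degree p. coeff p k *s (A ^^ k) v)"

definition split_space :: "nat \<Rightarrow> (nat \<Rightarrow> 'b \<Rightarrow> 'b) \<Rightarrow> (nat \<Rightarrow> 'b \<Rightarrow> 'b) \<Rightarrow> nat \<Rightarrow> 'b set" where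
  "split_space d E Es i = (\<Sum>j\<in>{0..i}. range (Es j)) \<inter> (\<Sum>j\<in>{i..d}. range (E j))"

text \<open>\<open>shift_prod A [c\<^sub>1, \<dots>, c\<^sub>n]\<close> is the operator product \<open>(A - c\<^sub>1 I) \<cdots> (A - c\<^sub>n I)\<close>.\<close>

definition shift_prod :: "('b \<Rightarrow> 'b) \<Rightarrow> 'a list \<Rightarrow> 'b \<Rightarrow> 'b" where
  "shift_prod A cs = foldr (\<lambda>c f. (\<lambda>v. A v - c *s v) \<circ> f) cs id"

definition split_seq ::
    "nat \<Rightarrow> ('b \<Rightarrow> 'b) \<Rightarrow> (nat \<Rightarrow> 'b \<Rightarrow> 'b) \<Rightarrow> ('b \<Rightarrow> 'b) \<Rightarrow> (nat \<Rightarrow> 'b \<Rightarrow> 'b) \<Rightarrow> nat \<Rightarrow> 'a" where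
  "split_seq d A E As Es i =
     eigenvalue_on
       (shift_prod As (map (eigenvalue_seq As Es) [1..<Suc i]) \<circ>
        shift_prod A (map (eigenvalue_seq A E) (rev [0..<i])))
       (split_space d E Es 0)"

end

definition tau :: "(nat \<Rightarrow> 'a::field) \<Rightarrow> nat \<Rightarrow> 'a poly" where
  "tau \<theta> i = (\<Prod>j<i. [:- \<theta> j, 1:])"

end

theory Submission
  imports Defs
begin

text \<open>
  Put \<open>\<eta>\<^sub>i = (\<lambda> - \<theta>\<^sup>*\<^sub>1) \<cdots> (\<lambda> - \<theta>\<^sup>*\<^sub>i)\<close>, so that \<open>\<eta>\<^sub>i(A\<^sup>*) \<tau>\<^sub>i(A)\<close> acts on \<open>E\<^sup>*\<^sub>0V\<close> as \<open>\<zeta>\<^sub>i\<close>.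
  By tridiagonality \<open>E\<^sub>0 q(A\<^sup>*) \<tau>\<^sub>i(A) = 0\<close> and \<open>\<tau>\<^sub>i(A) q(A\<^sup>*) E\<^sub>0 = 0\<close> whenever \<open>deg q < i\<close>, so in both
  identities \<open>\<tau>\<^sup>*\<^sub>i\<close> may be replaced by \<open>\<eta>\<^sub>i\<close>, which is also monic of degree \<open>i\<close>. The first identity
  follows at once. The second holds because \<open>E\<^sup>*\<^sub>0 \<tau>\<^sub>i(A) \<eta>\<^sub>i(A\<^sup>*) = \<zeta>\<^sub>i E\<^sup>*\<^sub>0\<close>: both sides vanish on
  \<open>E\<^sup>*\<^sub>jV\<close> for \<open>1 \<le> j \<le> i\<close> since \<open>\<eta>\<^sub>i(\<theta>\<^sup>*\<^sub>j) = 0\<close>, and for \<open>j > i\<close> by tridiagonality, while on \<open>E\<^sup>*\<^sub>0V\<close>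
  the factor \<open>\<eta>\<^sub>i(A\<^sup>*)\<close> is the scalar \<open>\<eta>\<^sub>i(\<theta>\<^sup>*\<^sub>0)\<close> and can be moved to the left of \<open>\<tau>\<^sub>i(A)\<close>.
  That \<open>E\<^sup>*\<^sub>0V\<close> is one-dimensional like \<open>E\<^sub>0V\<close> follows from irreducibility, which makes \<open>E\<^sub>0\<close> injective
  on \<open>E\<^sup>*\<^sub>0V\<close>.
\<close>

subsection \<open>Polynomials in an operator\<close>

lemma degree_diff_less_of_lead_coeff_1:
  fixes p q :: "'a::comm_ring_1 poly"
  assumes "lead_coeff p = 1" "lead_coeff q = 1" "degree p = n" "degree q = n" "p \<noteq> q"
  shows "degree (p - q) < n"
proof (rule ccontr)
  assume "\<not> degree (p - q) < n"
  moreover have "degree (p - q) \<le> n"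
    using assms by (intro degree_diff_le) auto
  ultimately have "degree (p - q) = n" by simp
  then have "lead_coeff (p - q) = coeff p (degree p) - coeff q (degree q)"
    by (simp add: assms(3,4))
  then have "lead_coeff (p - q) = 0"
    using assms(1,2) by simp
  then show False using assms(5) by (simp only: leading_coeff_0_iff right_minus_eq)
qed

lemma lead_coeff_linear_factors: "lead_coeff (\<Prod>c\<leftarrow>cs. [:- c, 1:]) = (1 :: 'a::idom)"
  by (induction cs) (simp_all add: lead_coeff_mult del: mult_pCons_left)

lemma degree_linear_factors: "degree (\<Prod>c\<leftarrow>cs. [:- c, 1 :: 'a::idom:]) = length cs"
proof (induction cs)
  case (Cons c cs)
  have "(\<Prod>c\<leftarrow>cs. [:- c, 1:]) \<noteq> 0"
    using lead_coeff_linear_factors[of cs] by auto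
  then show ?case using Cons by (simp add: degree_mult_eq del: mult_pCons_left)
qed simp

lemma poly_linear_factors: "poly (\<Prod>c\<leftarrow>cs. [:- c, 1:]) (x :: 'a::comm_ring_1) = (\<Prod>c\<leftarrow>cs. x - c)"
  by (induction cs) (simp_all add: algebra_simps del: mult_pCons_left)

text \<open>The reversed list gives the factors in the order used by \<open>split_seq\<close>,
  highest index first, so that \<open>tau\<close> can be matched with its
  \<open>shift_prod\<close>.\<close>

lemma tau_eq_linear_factors: "tau \<theta> i = (\<Prod>c\<leftarrow>map \<theta> (rev [0..<i]). [:- c, 1:])"
  unfolding tau_def by (induction i) (simp_all del: mult_pCons_left mult_pCons_right add: mult.commute)

lemma lead_coeff_tau: "lead_coeff (tau \<theta> i) = 1"
  unfolding tau_eq_linear_factors by (rule lead_coeff_linear_factors)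

lemma degree_tau: "degree (tau \<theta> i) = i"
  unfolding tau_eq_linear_factors degree_linear_factors by simp

context linear_space
begin

lemma linear_operator:
  assumes "Vector_Spaces.linear scale scale F"
  shows "F (x + y) = F x + F y" "F (x - y) = F x - F y" "F (c *s x) = c *s F x" "F 0 = 0"
    and "F (\<Sum>i\<in>I. g i) = (\<Sum>i\<in>I. F (g i))"
proof -
  interpret F: Vector_Spaces.linear scale scale F by fact
  show "F (x + y) = F x + F y" "F (x - y) = F x - F y" "F (c *s x) = c *s F x" "F 0 = 0"
    and "F (\<Sum>i\<in>I. g i) = (\<Sum>i\<in>I. F (g i))"
    by (simp_all add: F.add F.diff F.scale F.sum)
qed

lemma subspace_eigenspace:
  assumes "Vector_Spaces.linear scale scale A"
  shows "subspace (eigenspace A c)"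
  by (rule subspaceI)
    (auto simp: eigenspace_def linear_operator[OF assms] scale_right_distrib scale_left_commute)

lemma span_invariant:
  assumes "Vector_Spaces.linear scale scale F" "\<And>v. v \<in> S \<Longrightarrow> F v \<in> span S"
  shows "F ` span S \<subseteq> span S"
proof clarify
  fix v assume "v \<in> span S"
  then show "F v \<in> span S"
  proof (induction rule: span_induct)
    case base
    show ?case
      unfolding mem_Collect_eq
      by (rule subspaceI)
        (auto simp: linear_operator[OF assms(1)] span_zero span_add span_scale)
  next
    case (step v)
    then show ?case using assms(2) by blast
  qed
qed

lemma dim_one_multiple:
  assumes "dim S = 1" "x \<in> S" "y \<in> S" "x \<noteq> 0"
  obtains c where "y = c *s x"
proof -
  obtain B where B: "B \<subseteq> S" "independent B" "S \<subseteq> span B" "card B = dim S"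
    using basis_exists by blast
  then obtain b where "B = {b}" using assms(1) card_1_singletonE by metis
  then have "S \<subseteq> range (\<lambda>k. k *s b)" using B(3) by (simp add: span_singleton)
  then obtain k l where kl: "x = k *s b" "y = l *s b"
    using assms(2,3) by blast
  then have "k \<noteq> 0" using assms(4) by auto
  then have "y = (l / k) *s x" using kl by simp
  then show ?thesis using that by blast
qed

lemma poly_end_0 [simp]: "poly_end 0 A v = 0"
  by (simp add: poly_end_def)

text \<open>Padding with zero coefficients gives sums over one common index range, which makes
  addition of polynomials coefficientwise.\<close>

lemma poly_end_eq_sum:
  assumes "degree p \<le> n"
  shows "poly_end p A v = (\<Sum>k\<le>n. coeff p k *s (A ^^ k) v)"
  unfolding poly_end_def
  by (rule sum.mono_neutral_left) (use assms in \<open>auto simp: coeff_eq_0\<close>)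

lemma poly_end_add: "poly_end (p + q) A v = poly_end p A v + poly_end q A v"
proof -
  let ?n = "max (degree p) (degree q)"
  have "degree (p + q) \<le> ?n" by (rule degree_add_le_max)
  then show ?thesis
    by (simp add: poly_end_eq_sum[of _ ?n] scale_left_distrib sum.distrib)
qed

lemma poly_end_diff: "poly_end (p - q) A v = poly_end p A v - poly_end q A v"
  using poly_end_add[of "p - q" q A v] by simp

lemma poly_end_smult: "poly_end (smult c p) A v = c *s poly_end p A v"
  using degree_smult_le[of c p]
  by (simp add: poly_end_eq_sum[of _ "degree p"] scale_sum_right)

context
  fixes A :: "'b \<Rightarrow> 'b"
  assumes lin: "Vector_Spaces.linear scale scale A"
begin

lemma poly_end_pCons: "poly_end (pCons a p) A v = a *s v + A (poly_end p A v)"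
proof -
  have "poly_end (pCons a p) A v = (\<Sum>k\<le>Suc (degree p). coeff (pCons a p) k *s (A ^^ k) v)"
    by (rule poly_end_eq_sum) (simp add: degree_pCons_le)
  also have "\<dots> = a *s v + (\<Sum>k\<le>degree p. coeff p k *s A ((A ^^ k) v))"
    by (subst sum.atMost_Suc_shift) simp
  also have "\<dots> = a *s v + A (poly_end p A v)"
    by (simp add: poly_end_def linear_operator[OF lin])
  finally show ?thesis .
qed

lemma poly_end_mult: "poly_end (p * q) A v = poly_end p A (poly_end q A v)"
proof (induction p)
  case (pCons a p)
  have "poly_end (pCons a p * q) A v = poly_end (smult a q + pCons 0 (p * q)) A v"
    by simp
  then show ?case
    by (simp add: poly_end_add poly_end_smult poly_end_pCons pCons)
qed simp

lemma poly_end_linear_factors: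
  "poly_end (\<Prod>c\<leftarrow>cs. [:- c, 1:]) A = shift_prod A cs"
proof (rule ext)
  show "poly_end (\<Prod>c\<leftarrow>cs. [:- c, 1:]) A v = shift_prod A cs v" for v
  proof (induction cs)
    case Nil
    then show ?case by (simp add: shift_prod_def poly_end_def)
  next
    case (Cons c cs)
    have "poly_end [:- c, 1:] A w = A w - c *s w" for w
      by (simp add: poly_end_pCons linear_operator[OF lin])
    with Cons show ?case
      by (simp add: poly_end_mult shift_prod_def del: mult_pCons_left)
  qed
qed

lemma poly_end_eigenvector:
  assumes "A v = c *s v"
  shows "poly_end p A v = poly p c *s v"
  by (induction p)
    (simp_all add: poly_end_pCons assms linear_operator[OF lin] scale_left_distrib mult.commute)

lemma linear_poly_end: "Vector_Spaces.linear scale scale (poly_end p A)"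
proof (induction p)
  case 0
  have "Vector_Spaces.linear scale scale (\<lambda>v. 0)"
    unfolding Vector_Spaces.linear_iff by (simp add: vector_space_axioms)
  then show ?case by simp
next
  case (pCons a p)
  then show ?case
    unfolding Vector_Spaces.linear_iff poly_end_pCons
    by (simp add: linear_operator[OF lin] linear_operator[OF pCons(2)] scale_right_distrib
        scale_left_commute vector_space_axioms add_ac)
qed

end

end

subsection \<open>Decompositions into eigenspaces with a tridiagonal action\<close>

text \<open>Only one operator is graded here, the other acting tridiagonally, so that the locale can
  be used twice with the two operators exchanged. \<open>E_B_E\<close> expresses tridiagonality
  through the projections.\<close>

locale tridiagonal_grading = linear_space scale
  for scale :: "'a::field \<Rightarrow> 'b::ab_group_add \<Rightarrow> 'b" (infixr "*s" 75) +
  fixes d :: nat and A B :: "'b \<Rightarrow> 'b" and E :: "nat \<Rightarrow> 'b \<Rightarrow> 'b" and \<theta> :: "nat \<Rightarrow> 'a"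
  assumes linear_A: "Vector_Spaces.linear scale scale A"
    and linear_B: "Vector_Spaces.linear scale scale B"
    and linear_E: "i \<le> d \<Longrightarrow> Vector_Spaces.linear scale scale (E i)"
    and E_idem: "i \<le> d \<Longrightarrow> E i (E i v) = E i v"
    and E_orth: "i \<le> d \<Longrightarrow> j \<le> d \<Longrightarrow> i \<noteq> j \<Longrightarrow> E i (E j v) = 0"
    and sum_E: "(\<Sum>i\<le>d. E i v) = v"
    and A_E: "i \<le> d \<Longrightarrow> A (E i v) = \<theta> i *s E i v"
    and E_B_E: "i \<le> d \<Longrightarrow> j \<le> d \<Longrightarrow> Suc i < j \<or> Suc j < i \<Longrightarrow> E i (B (E j v)) = 0"
begin

lemmas A_simps = linear_operator[OF linear_A]
lemmas B_simps = linear_operator[OF linear_B]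
lemmas E_simps = linear_operator[OF linear_E]

text \<open>This is the sum of the ranges of \<open>E j\<close> for \<open>j < n\<close>, hence zero
  for \<open>n = 0\<close>. Vanishing components are easier to track than sums of sets.\<close>

definition lower :: "nat \<Rightarrow> 'b set" where
  "lower n = {v. \<forall>j\<le>d. n \<le> j \<longrightarrow> E j v = 0}"

text \<open>The sum of the ranges of \<open>E j\<close> for \<open>n \<le> j \<le> d\<close>, hence
  zero once \<open>n\<close> exceeds \<open>d\<close>.\<close>

definition upper :: "nat \<Rightarrow> 'b set" where
  "upper n = {v. \<forall>j\<le>d. j < n \<longrightarrow> E j v = 0}"

lemma eq_0_iff_components: "v = 0 \<longleftrightarrow> (\<forall>j\<le>d. E j v = 0)"
proof
  assume "\<forall>j\<le>d. E j v = 0"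
  then have "(\<Sum>i\<le>d. E i v) = 0" by simp
  then show "v = 0" by (simp only: sum_E)
qed (simp add: E_simps)

lemma E_linear_expand:
  assumes "i \<le> d" "Vector_Spaces.linear scale scale F"
  shows "E i (F v) = (\<Sum>j\<le>d. E i (F (E j v)))"
proof -
  have "E i (F v) = E i (F (\<Sum>j\<le>d. E j v))" by (simp add: sum_E)
  then show ?thesis using assms by (simp add: E_simps linear_operator[OF assms(2)])
qed

lemma E_poly_A:
  assumes "i \<le> d"
  shows "E i (poly_end p A v) = poly p (\<theta> i) *s E i v"
proof -
  have "E i (poly_end p A (E j v)) = (if j = i then poly p (\<theta> i) *s E i v else 0)"
    if "j \<le> d" for j
    using that assms
    by (simp add: poly_end_eigenvector[OF linear_A A_E] E_simps E_idem E_orth)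
  then show ?thesis
    using assms by (subst E_linear_expand) (simp_all add: linear_poly_end linear_A)
qed

lemma E_A:
  assumes "i \<le> d"
  shows "E i (A v) = \<theta> i *s E i v"
  using E_poly_A[OF assms, of "[:0, 1:]" v] by (simp add: poly_end_pCons linear_A A_simps)

lemma subspace_lower: "subspace (lower n)"
  by (rule subspaceI) (auto simp: lower_def E_simps)

lemma subspace_upper: "subspace (upper n)"
  by (rule subspaceI) (auto simp: upper_def E_simps)

lemma upper_mono: "m \<le> n \<Longrightarrow> upper n \<subseteq> upper m"
  by (auto simp: upper_def)

lemma lower_mono: "m \<le> n \<Longrightarrow> lower m \<subseteq> lower n"
  by (auto simp: lower_def)

lemma B_lower:
  assumes "v \<in> lower n"
  shows "B v \<in> lower (Suc n)"
  unfolding lower_def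
proof clarify
  fix i assume i: "i \<le> d" "Suc n \<le> i"
  have "E i (B (E j v)) = 0" if "j \<le> d" for j
  proof (cases "n \<le> j")
    case True
    then show ?thesis using assms that i by (simp add: lower_def B_simps E_simps)
  next
    case False
    then show ?thesis using that i E_B_E by simp
  qed
  then show "E i (B v) = 0" using i by (subst E_linear_expand) (simp_all add: linear_B)
qed

lemma B_upper:
  assumes "v \<in> upper (Suc n)"
  shows "B v \<in> upper n"
  unfolding upper_def
proof clarify
  fix i assume i: "i \<le> d" "i < n"
  have "E i (B (E j v)) = 0" if "j \<le> d" for j
  proof (cases "j < Suc n")
    case True
    then show ?thesis using assms that i by (simp add: upper_def B_simps E_simps)
  next
    case False
    then show ?thesis using that i E_B_E by simp
  qed
  then show "E i (B v) = 0" using i by (subst E_linear_expand) (simp_all add: linear_B)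
qed

text \<open>Each application of \<open>B\<close> reaches at most one index further; the induction
  follows Horner's scheme.\<close>

lemma poly_B_lower:
  assumes "v \<in> lower n"
  shows "poly_end p B v \<in> lower (n + degree p)"
proof (induction p)
  case 0
  show ?case by (simp add: subspace_0 subspace_lower)
next
  case (pCons a p)
  show ?case
  proof (cases "p = 0")
    case True
    then show ?thesis
      using assms by (simp add: poly_end_pCons linear_B B_simps subspace_scale subspace_lower)
  next
    case False
    \<comment> \<open>The constant term contributes a multiple of \<open>v\<close>, which must lie
      in the larger space reached by the other summand.\<close>
    have "v \<in> lower (Suc (n + degree p))"
      using assms lower_mono[of n "Suc (n + degree p)"] by auto
    then show ?thesis
      using False B_lower[OF pCons(2)]
      by (simp add: poly_end_pCons linear_B subspace_scale subspace_add subspace_lower)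
  qed
qed

text \<open>Each application of \<open>B\<close> costs one index at the lower end. Here
  \<open>n\<close> varies because the induction hypothesis is used at \<open>Suc n\<close>.\<close>

lemma poly_B_upper:
  assumes "v \<in> upper (n + degree p)"
  shows "poly_end p B v \<in> upper n"
  using assms
proof (induction p arbitrary: n)
  case 0
  show ?case by (simp add: subspace_0 subspace_upper)
next
  case (pCons a p)
  show ?case
  proof (cases "p = 0")
    case True
    then show ?thesis
      using pCons(3) by (simp add: poly_end_pCons linear_B B_simps subspace_scale subspace_upper)
  next
    case False
    have "v \<in> upper n"
      using pCons(3) upper_mono[of n "n + degree (pCons a p)"] by auto
    moreover have "poly_end p B v \<in> upper (Suc n)"
      using False pCons(2)[of "Suc n"] pCons(3) by simp
    ultimately show ?thesis
      using B_upper
      by (simp add: poly_end_pCons linear_B subspace_scale subspace_add subspace_upper)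
  qed
qed

text \<open>The roots of \<open>tau \<theta> n\<close> include \<open>\<theta> j\<close> for every
  \<open>j < n\<close>, so exactly these components are sure to be killed.\<close>

lemma tau_A_upper: "poly_end (tau \<theta> n) A v \<in> upper n"
  by (auto simp: upper_def E_poly_A tau_def poly_prod)

lemma tau_A_lower_eq_0:
  assumes "v \<in> lower n"
  shows "poly_end (tau \<theta> n) A v = 0"
proof (rule eq_0_iff_components[THEN iffD2], clarify)
  fix j assume "j \<le> d"
  then show "E j (poly_end (tau \<theta> n) A v) = 0"
    using assms by (cases "j < n") (auto simp: E_poly_A tau_def poly_prod lower_def)
qed

lemma E_0_lower: "E 0 v \<in> lower 1"
  by (auto simp: lower_def E_orth)

text \<open>Fewer than \<open>n\<close> applications of \<open>B\<close> cannot descend from index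
  \<open>n\<close> to index 0.\<close>

lemma E_0_poly_B_upper:
  assumes "degree p < n" "v \<in> upper n"
  shows "E 0 (poly_end p B v) = 0"
proof -
  have "v \<in> upper (1 + degree p)"
    using assms upper_mono[of "1 + degree p" n] by auto
  then show ?thesis
    using poly_B_upper[of v 1 p] by (simp add: upper_def)
qed

text \<open>Two monic polynomials of degree \<open>n\<close> differ by one of smaller degree, which
  \<open>E_0_poly_B_upper\<close> annihilates. This exchanges \<open>tau\<close> and
  \<open>eta\<close> in the first identity.\<close>

lemma E_0_poly_B_monic_cong:
  assumes "lead_coeff p = 1" "lead_coeff q = 1" "degree p = n" "degree q = n" "v \<in> upper n"
  shows "E 0 (poly_end p B v) = E 0 (poly_end q B v)"
proof (cases "p = q")
  case False
  then have "degree (p - q) < n"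
    using assms degree_diff_less_of_lead_coeff_1 by blast
  then have "E 0 (poly_end (p - q) B v) = 0"
    using assms by (intro E_0_poly_B_upper)
  then show ?thesis by (simp add: poly_end_diff E_simps)
qed simp

text \<open>The counterpart for the second identity: a polynomial in \<open>B\<close> of degree
  below \<open>n\<close> keeps the range of \<open>E 0\<close> inside \<open>lower n\<close>, where
  \<open>tau \<theta> n\<close> of \<open>A\<close> vanishes.\<close>

lemma tau_A_poly_B_monic_cong:
  assumes "lead_coeff p = 1" "lead_coeff q = 1" "degree p = n" "degree q = n"
  shows "poly_end (tau \<theta> n) A (poly_end p B (E 0 v)) = poly_end (tau \<theta> n) A (poly_end q B (E 0 v))"
proof (cases "p = q")
  case False
  then have "degree (p - q) < n"
    using assms degree_diff_less_of_lead_coeff_1 by blast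
  then have "poly_end (p - q) B (E 0 v) \<in> lower n"
    using poly_B_lower[OF E_0_lower, of "p - q" v] lower_mono[of "1 + degree (p - q)" n] by auto
  then have "poly_end (tau \<theta> n) A (poly_end (p - q) B (E 0 v)) = 0"
    by (rule tau_A_lower_eq_0)
  then show ?thesis
    by (simp add: poly_end_diff linear_operator[OF linear_poly_end] linear_A)
qed simp

end

subsection \<open>Sharp tridiagonal systems\<close>

text \<open>The two gradings exchange the roles of \<open>A\<close> and \<open>As\<close>. Sharpness
  is imposed on \<open>E 0\<close>; its dual form is derived in
  \<open>range_Es_0_multiple\<close>.\<close>

locale sharp_tridiagonal_gradings =
  linear_space scale +
  primary: tridiagonal_grading scale d A As E \<theta> +
  dual: tridiagonal_grading scale d As A Es \<theta>s
  for scale :: "'a::field \<Rightarrow> 'b::ab_group_add \<Rightarrow> 'b" (infixr "*s" 75)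
    and d A As E Es \<theta> \<theta>s +
  assumes irreducible: "subspace W \<Longrightarrow> A ` W \<subseteq> W \<Longrightarrow> As ` W \<subseteq> W \<Longrightarrow> W = {0} \<or> W = UNIV"
    and dim_E_0: "dim (range (E 0)) = 1"
    and E_0_nonzero: "range (E 0) \<noteq> {0}"
    and Es_0_nonzero: "range (Es 0) \<noteq> {0}"
begin

lemmas linear_poly_simps =
  linear_operator[OF linear_poly_end[OF primary.linear_A]]
  linear_operator[OF linear_poly_end[OF dual.linear_A]]

text \<open>
  The subspaces \<open>(E\<^sup>*\<^sub>0V + \<dots> + E\<^sup>*\<^sub>iV) \<inter> (E\<^sub>i\<^sub>+\<^sub>1V + \<dots> + E\<^sub>dV)\<close> are shifted into each other by
  \<open>A - \<theta>\<^sub>i\<^sub>+\<^sub>1 I\<close> and \<open>A\<^sup>* - \<theta>\<^sup>*\<^sub>i I\<close>, so they span an invariant subspace, which is proper because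
  \<open>E\<^sub>0\<close> vanishes on it.
\<close>

lemma lower_Int_upper_eq_0: "dual.lower (Suc i) \<inter> primary.upper (Suc i) = {0}"
proof -
  define S where "S = (\<Union>i. dual.lower (Suc i) \<inter> primary.upper (Suc i))"
  have S: "v \<in> span S" if "v \<in> dual.lower (Suc i)" "v \<in> primary.upper (Suc i)" for v i
    using that by (auto simp: S_def intro!: span_base)
  have A: "A v \<in> span S" if vS: "v \<in> S" for v
  proof -
    obtain i where v: "v \<in> dual.lower (Suc i)" "v \<in> primary.upper (Suc i)"
      using vS by (auto simp: S_def)
    \<comment> \<open>The shift uses \<open>\<theta> (Suc i)\<close>, an eigenvalue only for
      \<open>Suc i \<le> d\<close>; otherwise \<open>primary.upper (Suc i)\<close> is zero.\<close>
    show ?thesis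
    proof (cases "Suc i \<le> d")
      case True
      define w where "w = A v - \<theta> (Suc i) *s v"
      have "v \<in> dual.lower (Suc (Suc i))"
        using v dual.lower_mono[of "Suc i" "Suc (Suc i)"] by auto
      then have "w \<in> dual.lower (Suc (Suc i))"
        using dual.B_lower[OF v(1)] dual.subspace_lower
        by (simp add: w_def subspace_diff subspace_scale)
      moreover have "w \<in> primary.upper (Suc (Suc i))"
        using v(2) True
        by (auto simp: primary.upper_def w_def primary.E_simps primary.E_A less_Suc_eq)
      ultimately have "w + \<theta> (Suc i) *s v \<in> span S"
        using S v by (intro span_add span_scale) auto
      then show ?thesis by (simp add: w_def)
    next
      case False
      then have "v = 0"
        using v(2) by (subst primary.eq_0_iff_components) (auto simp: primary.upper_def)
      then show ?thesis by (simp add: primary.A_simps span_zero)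
    qed
  qed
  have As: "As v \<in> span S" if vS: "v \<in> S" for v
  proof -
    obtain i where v: "v \<in> dual.lower (Suc i)" "v \<in> primary.upper (Suc i)"
      using vS by (auto simp: S_def)
    show ?thesis
    proof (cases "i \<le> d")
      case True
      define w where "w = As v - \<theta>s i *s v"
      have "v \<in> primary.upper i"
        using v primary.upper_mono[of i "Suc i"] by auto
      then have w_upper: "w \<in> primary.upper i"
        using primary.B_upper[OF v(2)] primary.subspace_upper
        by (simp add: w_def subspace_diff subspace_scale)
      have w_lower: "w \<in> dual.lower i"
        unfolding dual.lower_def
      proof clarify
        fix j assume "j \<le> d" "i \<le> j"
        then show "Es j w = 0"
          using v(1)
          by (cases "j = i") (auto simp: dual.lower_def w_def dual.E_simps dual.E_A)
      qed
      \<comment> \<open>For \<open>i = 0\<close> the vector lies in \<open>dual.lower 0\<close>,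
        which is zero; for \<open>i = Suc k\<close> it lies in the member of the union with index
        \<open>k\<close>.\<close>
      have "w \<in> span S"
      proof (cases i)
        case 0
        then have "w = 0"
          using w_lower by (subst dual.eq_0_iff_components) (auto simp: dual.lower_def)
        then show ?thesis by (simp add: span_zero)
      next
        case (Suc k)
        then show ?thesis using S w_lower w_upper by auto
      qed
      then have "w + \<theta>s i *s v \<in> span S"
        using S v by (intro span_add span_scale) auto
      then show ?thesis by (simp add: w_def)
    next
      case False
      then have "v = 0"
        using v(2) by (subst primary.eq_0_iff_components) (auto simp: primary.upper_def)
      then show ?thesis by (simp add: dual.A_simps span_zero)
    qed
  qed
  have "span S = {0} \<or> span S = UNIV"
    using A As primary.linear_A dual.linear_A by (intro irreducible span_invariant) auto
  moreover have "span S \<noteq> UNIV"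
  proof
    assume "span S = UNIV"
    moreover have "S \<subseteq> primary.upper 1"
      by (auto simp: S_def primary.upper_def)
    then have "span S \<subseteq> primary.upper 1"
      using primary.subspace_upper by (intro span_minimal)
    ultimately have "E 0 v = 0" for v
      by (auto simp: primary.upper_def)
    then show False using E_0_nonzero by auto
  qed
  ultimately have "span S = {0}" by simp
  then show ?thesis
    using S[of _ i] primary.subspace_upper dual.subspace_lower by (auto simp: subspace_0)
qed

lemma E_0_inj_on_range_Es_0:
  assumes "E 0 (Es 0 v) = 0"
  shows "Es 0 v = 0"
proof -
  have "Es 0 v \<in> primary.upper (Suc 0)" using assms by (simp add: primary.upper_def)
  then show ?thesis using lower_Int_upper_eq_0[of 0] dual.E_0_lower[of v] by auto
qed

text \<open>Proportionality holds after applying \<open>E 0\<close>, whose range is a line, and is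
  pulled back by injectivity.\<close>

lemma range_Es_0_multiple:
  assumes "Es 0 x \<noteq> 0"
  obtains c where "Es 0 y = c *s Es 0 x"
proof -
  have "E 0 (Es 0 x) \<noteq> 0" using assms E_0_inj_on_range_Es_0 by blast
  then obtain c where "E 0 (Es 0 y) = c *s E 0 (Es 0 x)"
    by (rule dim_one_multiple[OF dim_E_0 rangeI rangeI])
  then have "E 0 (Es 0 (y - c *s x)) = 0"
    by (simp add: primary.E_simps dual.E_simps)
  then have "Es 0 (y - c *s x) = 0" by (rule E_0_inj_on_range_Es_0)
  then have "Es 0 y = c *s Es 0 x" by (simp add: dual.E_simps)
  then show ?thesis by (rule that)
qed

text \<open>The list of roots is the one in \<open>split_seq\<close>; it starts at index 1, leaving
  out \<open>\<theta>s 0\<close>.\<close>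

definition eta :: "nat \<Rightarrow> 'a poly" where
  "eta i = (\<Prod>c\<leftarrow>map \<theta>s [1..<Suc i]. [:- c, 1:])"

lemma poly_eta_eq_0: "1 \<le> j \<Longrightarrow> j \<le> i \<Longrightarrow> poly (eta i) (\<theta>s j) = 0"
  unfolding eta_def poly_linear_factors by (auto simp: prod_list_zero_iff image_iff simp del: upt_Suc)

lemma lead_coeff_eta: "lead_coeff (eta i) = 1"
  unfolding eta_def by (rule lead_coeff_linear_factors)

lemma degree_eta: "degree (eta i) = i"
  unfolding eta_def degree_linear_factors by simp

text \<open>Applying \<open>tau\<close> of \<open>A\<close> leads from the range of
  \<open>Es 0\<close> to components of index at most \<open>i\<close>, and \<open>eta\<close> of
  \<open>As\<close> kills those of index 1 to \<open>i\<close>.\<close>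

lemma eta_tau_range_Es_0:
  "Es 0 (poly_end (eta i) As (poly_end (tau \<theta> i) A (Es 0 v)))
    = poly_end (eta i) As (poly_end (tau \<theta> i) A (Es 0 v))" (is "Es 0 ?w = ?w")
proof -
  have "poly_end (tau \<theta> i) A (Es 0 v) \<in> dual.lower (Suc i)"
    using dual.poly_B_lower[OF dual.E_0_lower, of "tau \<theta> i" v] by (simp add: degree_tau)
  then have "Es j ?w = 0" if "j \<le> d" "1 \<le> j" for j
    using that by (cases "j \<le> i") (auto simp: dual.E_poly_A poly_eta_eq_0 dual.lower_def)
  then have "Es j (Es 0 ?w - ?w) = 0" if "j \<le> d" for j
    using that by (cases "j = 0") (auto simp: dual.E_simps dual.E_idem dual.E_orth)
  then have "Es 0 ?w - ?w = 0"
    by (subst dual.eq_0_iff_components) simp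
  then show ?thesis by simp
qed

lemma eta_tau_scalar_on_range_Es_0:
  "\<exists>z. \<forall>v. poly_end (eta i) As (poly_end (tau \<theta> i) A (Es 0 v)) = z *s Es 0 v"
proof -
  obtain x where x: "Es 0 x \<noteq> 0" using Es_0_nonzero dual.E_simps(4)[of 0] by auto
  obtain z where z: "poly_end (eta i) As (poly_end (tau \<theta> i) A (Es 0 x)) = z *s Es 0 x"
    using range_Es_0_multiple[OF x] eta_tau_range_Es_0 by metis
  have "poly_end (eta i) As (poly_end (tau \<theta> i) A (Es 0 v)) = z *s Es 0 v" for v
  proof -
    obtain c where "Es 0 v = c *s Es 0 x" by (rule range_Es_0_multiple[OF x])
    then show ?thesis by (simp add: linear_poly_simps z scale_left_commute)
  qed
  then show ?thesis by blast
qed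

context
  fixes i :: nat and z :: 'a
  assumes eta_tau: "\<And>v. poly_end (eta i) As (poly_end (tau \<theta> i) A (Es 0 v)) = z *s Es 0 v"
begin

lemma E_0_tau_tau_Es_0:
  "E 0 (poly_end (tau \<theta>s i) As (poly_end (tau \<theta> i) A (Es 0 v))) = z *s E 0 (Es 0 v)"
proof -
  have "E 0 (poly_end (tau \<theta>s i) As (poly_end (tau \<theta> i) A (Es 0 v)))
      = E 0 (poly_end (eta i) As (poly_end (tau \<theta> i) A (Es 0 v)))"
    by (rule primary.E_0_poly_B_monic_cong[OF lead_coeff_tau lead_coeff_eta degree_tau degree_eta
        primary.tau_A_upper])
  then show ?thesis by (simp add: eta_tau primary.E_simps)
qed

lemma Es_0_tau_eta: "Es 0 (poly_end (tau \<theta> i) A (poly_end (eta i) As x)) = z *s Es 0 x"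
proof -
  define y where "y = poly_end (eta i) As x"
  have "Es j (y - Es 0 y) = 0" if "j \<le> d" "j < Suc i" for j
    using that
    by (cases "j = 0")
      (auto simp: dual.E_simps dual.E_idem dual.E_orth y_def dual.E_poly_A poly_eta_eq_0)
  then have "y - Es 0 y \<in> dual.upper (Suc i)"
    by (simp add: dual.upper_def)
  \<comment> \<open>The degree of \<open>tau \<theta> i\<close> is one too small to get from index
    \<open>Suc i\<close> down to index 0.\<close>
  then have "Es 0 (poly_end (tau \<theta> i) A (y - Es 0 y)) = 0"
    by (rule dual.E_0_poly_B_upper[rotated]) (simp add: degree_tau)
  then have "Es 0 (poly_end (tau \<theta> i) A y) = Es 0 (poly_end (tau \<theta> i) A (Es 0 y))"
    by (simp add: linear_poly_simps dual.E_simps)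
  also have "\<dots> = poly (eta i) (\<theta>s 0) *s Es 0 (poly_end (tau \<theta> i) A (Es 0 x))"
    by (simp add: y_def dual.E_poly_A linear_poly_simps dual.E_simps)
  \<comment> \<open>After projection by \<open>Es 0\<close>, \<open>eta i\<close> of
    \<open>As\<close> is multiplication by its value at \<open>\<theta>s 0\<close>, so the scalar
    can be read as this operator on the left of \<open>tau\<close>.\<close>
  also have "\<dots> = Es 0 (poly_end (eta i) As (poly_end (tau \<theta> i) A (Es 0 x)))"
    by (simp add: dual.E_poly_A)
  also have "\<dots> = z *s Es 0 x"
    by (simp add: eta_tau dual.E_simps dual.E_idem)
  finally show ?thesis by (simp add: y_def)
qed

lemma Es_0_tau_tau_E_0:
  "Es 0 (poly_end (tau \<theta> i) A (poly_end (tau \<theta>s i) As (E 0 v))) = z *s Es 0 (E 0 v)"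
proof -
  have "poly_end (tau \<theta> i) A (poly_end (tau \<theta>s i) As (E 0 v))
      = poly_end (tau \<theta> i) A (poly_end (eta i) As (E 0 v))"
    by (rule primary.tau_A_poly_B_monic_cong[OF lead_coeff_tau lead_coeff_eta degree_tau degree_eta])
  then show ?thesis by (simp add: Es_0_tau_eta)
qed

end

end

section \<open>Tridiagonal systems as pairs of gradings\<close>

context linear_space
begin

text \<open>On every eigenspace \<open>F\<close> is the identity or zero, and by diagonalizability
  the eigenspaces span, so all values of \<open>F\<close> lie in the one eigenspace that it
  fixes.\<close>

lemma range_primitive_idempotent:
  assumes "Vector_Spaces.linear scale scale A" "diagonalizable A" "primitive_idempotent A F"
  shows "range F \<in> eigenspaces A"
    and "v \<in> range F \<Longrightarrow> F v = v"
    and "W \<in> eigenspaces A \<Longrightarrow> W \<noteq> range F \<Longrightarrow> v \<in> W \<Longrightarrow> F v = 0"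
proof -
  have F: "Vector_Spaces.linear scale scale F"
    using assms(3) by (simp add: primitive_idempotent_def)
  obtain U where U: "U \<in> eigenspaces A" "\<And>v. v \<in> U \<Longrightarrow> F v = v"
    "\<And>W v. W \<in> eigenspaces A \<Longrightarrow> W \<noteq> U \<Longrightarrow> v \<in> W \<Longrightarrow> F v = 0"
    using assms(3) unfolding primitive_idempotent_def by auto
  have sub: "subspace U"
    using U(1) subspace_eigenspace[OF assms(1)] by (auto simp: eigenspaces_def)
  have "F v \<in> U" for v
  proof -
    have "subspace {v. F v \<in> U}"
      by (rule subspaceI) (auto simp: linear_operator[OF F] sub subspace_0 subspace_add subspace_scale)
    moreover have "\<Union> (eigenspaces A) \<subseteq> {v. F v \<in> U}"
      using U(2,3) sub subspace_0 by fastforce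
    ultimately have "span (\<Union> (eigenspaces A)) \<subseteq> {v. F v \<in> U}"
      by (rule span_minimal[rotated])
    then show ?thesis using assms(2) by (auto simp: diagonalizable_def)
  qed
  then have "range F = U" using U(2) by (metis image_subsetI rangeI subsetI subset_antisym)
  with U show "range F \<in> eigenspaces A"
    and "v \<in> range F \<Longrightarrow> F v = v"
    and "W \<in> eigenspaces A \<Longrightarrow> W \<noteq> range F \<Longrightarrow> v \<in> W \<Longrightarrow> F v = 0"
    by auto
qed

lemma eigenvalue_on_eigenspace:
  assumes "W \<in> eigenspaces A" "subspace W" "v \<in> W"
  shows "A v = eigenvalue_on A W *s v"
proof -
  obtain c where c: "W = eigenspace A c" "W \<noteq> {0}"
    using assms(1) by (auto simp: eigenspaces_def)
  then obtain w where "w \<in> W" "w \<noteq> 0" using assms(2) subspace_0 by blast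
  then have "eigenvalue_on A W = c"
    by (rule eigenvalue_on_eqI) (simp add: c eigenspace_def)
  then show ?thesis using assms(3) c(1) by (simp add: eigenspace_def)
qed

lemma tridiagonal_gradingI:
  assumes linear: "Vector_Spaces.linear scale scale A" "Vector_Spaces.linear scale scale B"
    and diag: "diagonalizable A"
    and E: "\<And>i. i \<le> d \<Longrightarrow> primitive_idempotent A (E i)"
    and ord: "standard_ordering A B d (\<lambda>i. range (E i))"
  shows "tridiagonal_grading scale d A B E (eigenvalue_seq A E)"
proof -
  note idem = range_primitive_idempotent[OF linear(1) diag E]
  have bij: "bij_betw (\<lambda>i. range (E i)) {0..d} (eigenspaces A)"
    and tri: "\<And>i. i \<le> d \<Longrightarrow> B ` range (E i) \<subseteq> (if i = 0 then {0} else range (E (i - 1)))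
      + range (E i) + (if i = d then {0} else range (E (i + 1)))"
    using ord unfolding standard_ordering_def by blast+
  have lin_E: "Vector_Spaces.linear scale scale (E i)" if "i \<le> d" for i
    using E[OF that] by (simp add: primitive_idempotent_def)
  have orth: "E i v = 0" if "i \<le> d" "j \<le> d" "i \<noteq> j" "v \<in> range (E j)" for i j v
  proof -
    have "range (E j) \<noteq> range (E i)"
      using that bij unfolding bij_betw_def inj_on_def by auto
    then show ?thesis using idem(3) idem(1) that by blast
  qed
  show ?thesis
  proof (intro tridiagonal_grading.intro tridiagonal_grading_axioms.intro)
    fix i v assume i: "i \<le> d"
    show "Vector_Spaces.linear scale scale (E i)" using i by (rule lin_E)
    show "E i (E i v) = E i v" using idem(2)[OF i] by blast
    have "subspace (range (E i))"
      using idem(1)[OF i] subspace_eigenspace[OF linear(1)] by (auto simp: eigenspaces_def)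
    then show "A (E i v) = eigenvalue_seq A E i *s E i v"
      unfolding eigenvalue_seq_def using idem(1)[OF i] by (intro eigenvalue_on_eigenspace) auto
  next
    fix i j v assume "i \<le> d" "j \<le> d" "i \<noteq> j"
    then show "E i (E j v) = 0" using orth by blast
  next
    fix v
    \<comment> \<open>The vectors fixed by the sum of the projections form a subspace; it contains
      every eigenspace and hence is everything.\<close>
    have "subspace {v. (\<Sum>i\<le>d. E i v) = v}"
      by (rule subspaceI) (simp_all add: linear_operator[OF lin_E] sum.distrib flip: scale_sum_right)
    moreover have "(\<Sum>i\<le>d. E i w) = w" if W: "W \<in> eigenspaces A" "w \<in> W" for w W
    proof -
      have "W \<in> (\<lambda>i. range (E i)) ` {0..d}" using bij W(1) by (simp add: bij_betw_def)
      then obtain j where j: "j \<le> d" "w \<in> range (E j)" using W(2) by auto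
      then have "E i w = (if i = j then w else 0)" if "i \<le> d" for i
        using orth[OF that j(1) _ j(2)] idem(2)[OF j] by simp
      then show ?thesis using j(1) by simp
    qed
    then have "\<Union> (eigenspaces A) \<subseteq> {v. (\<Sum>i\<le>d. E i v) = v}" by blast
    ultimately have "span (\<Union> (eigenspaces A)) \<subseteq> {v. (\<Sum>i\<le>d. E i v) = v}"
      by (rule span_minimal[rotated])
    then show "(\<Sum>i\<le>d. E i v) = v" using diag by (auto simp: diagonalizable_def)
  next
    fix i j v assume ij: "i \<le> d" "j \<le> d" "Suc i < j \<or> Suc j < i"
    \<comment> \<open>The three summands sit at indices \<open>j - 1\<close>, \<open>j\<close> and
      \<open>j + 1\<close>, all different from \<open>i\<close>; at the two ends the missing
      neighbour contributes zero.\<close>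
    obtain x y z where xyz: "B (E j v) = x + y + z" "y \<in> range (E j)"
      "x \<in> (if j = 0 then {0} else range (E (j - 1)))"
      "z \<in> (if j = d then {0} else range (E (j + 1)))"
      using subsetD[OF tri[OF ij(2)] imageI[OF rangeI[of "E j" v]]]
      by (blast elim: set_plus_elim)
    note E_i = linear_operator[OF lin_E[OF ij(1)]]
    have "E i x = 0"
      using xyz(3) orth[of i "j - 1" x] ij E_i(4) by (auto split: if_splits)
    moreover have "E i y = 0"
      using xyz(2) orth[of i j y] ij by auto
    moreover have "E i z = 0"
      using xyz(4) orth[of i "j + 1" z] ij E_i(4) by (auto split: if_splits)
    ultimately show "E i (B (E j v)) = 0" by (simp add: xyz(1) E_i(1))
  qed (fact linear_space_axioms linear)+
qed

lemma sharp_tridiagonal_gradingsI: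
  assumes sys: "tridiagonal_system d A E As Es" and "sharp E"
  shows "sharp_tridiagonal_gradings scale d A As E Es (eigenvalue_seq A E) (eigenvalue_seq As Es)"
proof -
  have pair: "tridiagonal_pair A As"
    and idem: "bij_betw E {0..d} {F. primitive_idempotent A F}"
      "bij_betw Es {0..d} {F. primitive_idempotent As F}"
    and ord: "standard_ordering A As d (\<lambda>i. range (E i))"
      "standard_ordering As A d (\<lambda>i. range (Es i))"
    using sys by (auto simp: tridiagonal_system_def)
  have lin: "Vector_Spaces.linear scale scale A" "Vector_Spaces.linear scale scale As"
    and diag: "diagonalizable A" "diagonalizable As"
    using pair by (auto simp: tridiagonal_pair_def)
  have idem': "primitive_idempotent A (E i)" "primitive_idempotent As (Es i)" if "i \<le> d" for i
    using idem that unfolding bij_betw_def by auto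
  interpret primary: tridiagonal_grading scale d A As E "eigenvalue_seq A E"
    using lin diag(1) idem'(1) ord(1) by (rule tridiagonal_gradingI)
  interpret dual: tridiagonal_grading scale d As A Es "eigenvalue_seq As Es"
    using lin(2,1) diag(2) idem'(2) ord(2) by (rule tridiagonal_gradingI)
  show ?thesis
  proof unfold_locales
    show "W = {0} \<or> W = UNIV" if "subspace W" "A ` W \<subseteq> W" "As ` W \<subseteq> W" for W
      using pair that unfolding tridiagonal_pair_def by blast
    show "dim (range (E 0)) = 1" using assms(2) by (simp add: sharp_def)
    show "range (E 0) \<noteq> {0}"
      using range_primitive_idempotent(1)[OF lin(1) diag(1) idem'(1)[of 0]]
      by (simp add: eigenspaces_def)
    show "range (Es 0) \<noteq> {0}"
      using range_primitive_idempotent(1)[OF lin(2) diag(2) idem'(2)[of 0]]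
      by (simp add: eigenspaces_def)
  qed
qed

end

section \<open>Identification of the scalar with the split sequence\<close>

context tridiagonal_grading
begin

lemma split_space_0: "split_space d E F 0 = range (F 0)"
proof -
  have "v \<in> (\<Sum>j\<in>{0..d}. range (E j))" for v
  proof -
    have "v = (\<Sum>j\<in>{0..d}. E j v)" by (simp add: sum_E atLeast0AtMost)
    then show ?thesis by (auto simp: set_sum_alt)
  qed
  then show ?thesis by (auto simp: split_space_def)
qed

end

lemma (in linear_space) split_seq_identities:
  assumes "tridiagonal_system d A E As Es" "sharp E"
  defines "\<theta> \<equiv> eigenvalue_seq A E" and "\<theta>s \<equiv> eigenvalue_seq As Es"
    and "\<zeta> \<equiv> split_seq d A E As Es"
  shows "E 0 (poly_end (tau \<theta>s i) As (poly_end (tau \<theta> i) A (Es 0 v))) = \<zeta> i *s E 0 (Es 0 v)"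
    and "Es 0 (poly_end (tau \<theta> i) A (poly_end (tau \<theta>s i) As (E 0 v))) = \<zeta> i *s Es 0 (E 0 v)"
proof -
  interpret sharp_tridiagonal_gradings scale d A As E Es \<theta> \<theta>s
    unfolding \<theta>_def \<theta>s_def using assms(1,2) by (rule sharp_tridiagonal_gradingsI)
  obtain z where z: "\<And>v. poly_end (eta i) As (poly_end (tau \<theta> i) A (Es 0 v)) = z *s Es 0 v"
    using eta_tau_scalar_on_range_Es_0 by blast
  obtain x where x: "Es 0 x \<noteq> 0" using Es_0_nonzero dual.E_simps(4)[of 0] by auto
  \<comment> \<open>Both operator products in \<open>split_seq\<close> become polynomials in
    \<open>A\<close> and \<open>As\<close>. The nonzero vector \<open>Es 0 x\<close> then pins down
    the scalar as \<open>z\<close>.\<close>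
  have "\<zeta> i = eigenvalue_on (poly_end (eta i) As \<circ> poly_end (tau \<theta> i) A) (range (Es 0))"
    unfolding \<zeta>_def split_seq_def primary.split_space_0 tau_eq_linear_factors eta_def
      poly_end_linear_factors[OF primary.linear_A] poly_end_linear_factors[OF dual.linear_A]
    unfolding \<theta>_def \<theta>s_def ..
  also have "\<dots> = z"
    by (rule eigenvalue_on_eqI[OF _ x]) (use z in auto)
  finally have "\<zeta> i = z" .
  then show "E 0 (poly_end (tau \<theta>s i) As (poly_end (tau \<theta> i) A (Es 0 v))) = \<zeta> i *s E 0 (Es 0 v)"
    and "Es 0 (poly_end (tau \<theta> i) A (poly_end (tau \<theta>s i) As (E 0 v))) = \<zeta> i *s Es 0 (E 0 v)"
    using E_0_tau_tau_Es_0[OF z] Es_0_tau_tau_E_0[OF z] by simp_all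
qed

theorem theorem7p4:
  fixes scale :: "'a::field \<Rightarrow> 'b::ab_group_add \<Rightarrow> 'b"
    and Basis :: "'b set"
    and d :: nat
    and A As :: "'b \<Rightarrow> 'b"
    and E Es :: "nat \<Rightarrow> 'b \<Rightarrow> 'b"
    and \<theta> \<theta>s \<zeta> :: "nat \<Rightarrow> 'a"
  assumes "finite_dimensional_vector_space scale Basis"
    and "vector_space.dim scale (UNIV :: 'b set) > 0"
    and "linear_space.tridiagonal_system scale d A E As Es"
    and "linear_space.sharp scale E"
    and "\<And>i. i \<le> d \<Longrightarrow> \<theta> i = linear_space.eigenvalue_seq scale A E i"
    and "\<And>i. i \<le> d \<Longrightarrow> \<theta>s i = linear_space.eigenvalue_seq scale As Es i"
    and "\<And>i. i \<le> d \<Longrightarrow> \<zeta> i = linear_space.split_seq scale d A E As Es i"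
  shows "\<forall>i\<le>d.
      E 0 \<circ> linear_space.poly_end scale (tau \<theta>s i) As \<circ> linear_space.poly_end scale (tau \<theta> i) A \<circ> Es 0
        = (\<lambda>v. scale (\<zeta> i) (E 0 (Es 0 v))) \<and>
      Es 0 \<circ> linear_space.poly_end scale (tau \<theta> i) A \<circ> linear_space.poly_end scale (tau \<theta>s i) As \<circ> E 0
        = (\<lambda>v. scale (\<zeta> i) (Es 0 (E 0 v)))"
proof (intro allI impI)
  fix i assume i: "i \<le> d"
  interpret finite_dimensional_vector_space scale Basis by (fact assms(1))
  interpret linear_space scale by unfold_locales
  \<comment> \<open>The sequences are prescribed only up to index \<open>d\<close>, which suffices
    because \<open>tau\<close> uses indices below \<open>i\<close>.\<close>
  have "tau \<theta> i = tau (eigenvalue_seq A E) i" "tau \<theta>s i = tau (eigenvalue_seq As Es) i"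
    using i assms(5,6) by (auto simp: tau_def intro!: prod.cong)
  moreover have "\<zeta> i = split_seq d A E As Es i" using i by (rule assms(7))
  ultimately show "E 0 \<circ> poly_end (tau \<theta>s i) As \<circ> poly_end (tau \<theta> i) A \<circ> Es 0
        = (\<lambda>v. scale (\<zeta> i) (E 0 (Es 0 v))) \<and>
      Es 0 \<circ> poly_end (tau \<theta> i) A \<circ> poly_end (tau \<theta>s i) As \<circ> E 0
        = (\<lambda>v. scale (\<zeta> i) (Es 0 (E 0 v)))"
    using split_seq_identities[OF assms(3,4), of i] by (simp add: fun_eq_iff)
qed

end
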